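(* For every $d \ge 1$ and every $N$-vertex, $d$-regular graph $G$, the volume $i_V(G)$ of the stable set polytope of $G$ satisfies \[ i_V(G) \le i_V(K_{d,d})^{N/(2d)} = \binom{2d}{d}^{-N/(2d)}. \]
   Context: Graphs $G$ are finite, simple and undirected. An independent set (stable set) of $G$ is a set of vertices no two of which are adjacent. The stable set polytope of $G$ is the convex hull in $\mathbb{R}^{V(G)}$ of the characteristic vectors $\mathbf{1}_I$ of all independent sets $I$ of $G$ (including the empty set), and $i_V(G)$ denotes its ($|V(G)|$-dimensional Lebesgue) volume. $K_{d,d}$ is the complete bipartite graph with $d$ vertices on each side. *)

theory Defs
  imports "HOL-Analysis.Analysis" "Graph_Theory.Kuratowski"
begin

text \<open>
  A finite simple undirected graph is a symmetric loop-free digraph without parallel arcs: each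
  edge is represented by its two opposite arcs, so the degree of a vertex is its out-degree.
\<close>

definition regular_graph :: "('a, 'b) pre_digraph \<Rightarrow> nat \<Rightarrow> bool" where
  "regular_graph G d \<longleftrightarrow> graph G \<and> (\<forall>v\<in>verts G. out_degree G v = d)"

definition independent_set :: "('a, 'b) pre_digraph \<Rightarrow> 'a set \<Rightarrow> bool" where
  "independent_set G I \<longleftrightarrow> I \<subseteq> verts G \<and> (\<forall>u\<in>I. \<forall>v\<in>I. (u, v) \<notin> arcs_ends G)"

text \<open>
  The vector space of real functions on a vertex set \<open>V\<close> is rendered as \<open>extensional V\<close>, which is
  the underlying space of the product measure \<open>PiM V (\<lambda>_. lborel)\<close>.  The library constant \<open>convex\<close>
  does not apply, since this carrier is not a type; the following copies its definition, with the
  vector operations taken coordinatewise on \<open>V\<close>.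
\<close>

definition convex_on_coords :: "'a set \<Rightarrow> ('a \<Rightarrow> real) set \<Rightarrow> bool" where
  "convex_on_coords V C \<longleftrightarrow> C \<subseteq> extensional V \<and>
     (\<forall>x\<in>C. \<forall>y\<in>C. \<forall>u\<ge>0. \<forall>v\<ge>0. u + v = 1 \<longrightarrow> (\<lambda>i\<in>V. u * x i + v * y i) \<in> C)"

definition char_vector :: "'a set \<Rightarrow> 'a set \<Rightarrow> 'a \<Rightarrow> real" where
  "char_vector V I = restrict (indicator I) V"

definition stable_set_polytope :: "('a, 'b) pre_digraph \<Rightarrow> ('a \<Rightarrow> real) set" where
  "stable_set_polytope G =
     convex_on_coords (verts G) hull (char_vector (verts G) ` {I. independent_set G I})"

text \<open>
  The polytope is compact, hence Borel, so Borel-Lebesgue measure gives its Lebesgue volume.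
\<close>

definition stable_set_volume :: "('a, 'b) pre_digraph \<Rightarrow> real" where
  "stable_set_volume G = measure (PiM (verts G) (\<lambda>_. lborel)) (stable_set_polytope G)"

definition Kdd :: "nat \<Rightarrow> (nat + nat, (nat + nat) \<times> (nat + nat)) pre_digraph" where
  "Kdd d = with_proj \<lparr> pverts = Inl ` {..<d} \<union> Inr ` {..<d},
     parcs = Inl ` {..<d} \<times> Inr ` {..<d} \<union> Inr ` {..<d} \<times> Inl ` {..<d} \<rparr>"

lemma complete_bipartite_Kdd: "complete_bipartite_digraph d d (Kdd d)"
proof -
  let ?U = "Inl ` {..<d} :: (nat + nat) set" and ?V = "Inr ` {..<d} :: (nat + nat) set"
  have "?U \<inter> ?V = {}" "card ?U = d" "card ?V = d"
    by (auto simp: card_image)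
  then show ?thesis
    unfolding Kdd_def complete_bipartite_digraph_pair_def pair_pre_digraph.simps
    by blast
qed

text \<open>
  On a finite type as vertex set, the hull above is the library's convex hull in Euclidean space.
\<close>

lemma bij_vec_lambda: "bij (vec_lambda :: ('n::finite \<Rightarrow> real) \<Rightarrow> _)"
  by (rule bijI'[where f="vec_lambda"])
    (auto simp: vec_lambda_inject intro: exI[of _ "vec_nth _"] vec_nth_inverse[symmetric])

lemma convex_on_coords_UNIV:
  fixes C :: "('n::finite \<Rightarrow> real) set"
  shows "convex_on_coords UNIV C \<longleftrightarrow> convex (vec_lambda ` C)"
proof -
  have eq: "u *\<^sub>R vec_lambda x + v *\<^sub>R vec_lambda y = vec_lambda (\<lambda>i. u * x i + v * y i)"
    for u v :: real and x y :: "'n \<Rightarrow> real"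
    by (simp add: vec_eq_iff)
  have mem: "vec_lambda z \<in> vec_lambda ` C \<longleftrightarrow> z \<in> C" for z
    by (rule inj_image_mem_iff[OF bij_is_inj[OF bij_vec_lambda]])
  show ?thesis
    unfolding convex_on_coords_def convex_def ball_simps eq mem restrict_UNIV by simp
qed

lemma convex_on_coords_hull_UNIV:
  fixes S :: "('n::finite \<Rightarrow> real) set"
  shows "vec_lambda ` (convex_on_coords UNIV hull S) = convex hull (vec_lambda ` S)"
proof -
  note inj = bij_is_inj[OF bij_vec_lambda]
  have "vec_lambda ` (\<Inter>{C. convex_on_coords UNIV C \<and> S \<subseteq> C})
      = \<Inter>((`) vec_lambda ` {C. convex_on_coords UNIV C \<and> S \<subseteq> C})"
    using bij_image_INT[OF bij_vec_lambda, of "\<lambda>C. C"] by simp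
  also have "(`) vec_lambda ` {C. convex_on_coords UNIV C \<and> S \<subseteq> C}
      = {D. convex D \<and> vec_lambda ` S \<subseteq> D}"
  proof (intro equalityI subsetI)
    fix D :: "(real ^ 'n) set"
    assume "D \<in> {D. convex D \<and> vec_lambda ` S \<subseteq> D}"
    moreover have D: "D = vec_lambda ` (vec_lambda -` D)"
      by (rule surj_image_vimage_eq[OF bij_is_surj[OF bij_vec_lambda], symmetric])
    ultimately have "convex_on_coords UNIV (vec_lambda -` D)" "S \<subseteq> vec_lambda -` D"
      by (auto simp: convex_on_coords_UNIV)
    with D show "D \<in> (`) vec_lambda ` {C. convex_on_coords UNIV C \<and> S \<subseteq> C}"
      by blast
  qed (auto simp: convex_on_coords_UNIV)
  finally show ?thesis
    by (simp add: hull_def)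
qed

end

theory Submission
  imports Defs
begin

text \<open>
  Every point of the stable set polytope has coordinates in \<open>[0, 1]\<close> and satisfies
  \<open>x u + x v \<le> 1\<close> on each edge, so the volume of the larger polytope cut out by these
  inequalities is bounded instead.  For bipartite graphs, in particular for \<open>K\<^bsub>d,d\<^esub>\<close>, the two
  polytopes coincide, so nothing is lost in the extremal case.

  Up to a factor that tends to 1, the number of grid cells of side \<open>1 / m\<close> inside the polytope is
  the number of threshold labelings: maps \<open>k\<close> from the vertices to \<open>{0..m}\<close> with
  \<open>k u + k v \<le> m\<close> on each edge.  The inequality is therefore one between finite counts.

  Following Zhao's bipartite swapping trick, pairs of threshold labelings of \<open>G\<close> are mapped
  injectively to pairs \<open>(x, y)\<close> with \<open>x u + y v \<le> m\<close> whenever \<open>u\<close> and \<open>v\<close> are adjacent, that is,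
  to threshold labelings of the bipartite double cover
  (\<open>card_threshold_labelings_squared_le\<close>).  For fixed \<open>x\<close> the values of \<open>y\<close> are
  chosen independently, so the number of such pairs is the sum over \<open>x\<close> of a product over the
  vertices \<open>v\<close>, the factor at \<open>v\<close> depending on \<open>x\<close> only through the \<open>d\<close> neighbours of \<open>v\<close>.
  Each vertex is a neighbour of \<open>d\<close> vertices, and the generalised Hoelder inequality
  (\<open>finner_sum\<close>) bounds the sum by a product of identical factors, each the \<open>d\<close>-th root of the
  number of threshold labelings of \<open>K\<^bsub>d,d\<^esub>\<close>.

  That last number lies between two explicit binomial coefficients (\<open>Kdd_count_bounds_choose\<close>)
  and is asymptotic to \<open>m ^ (2 * d)\<close> divided by the central binomial coefficient.  Letting
  \<open>m\<close> tend to infinity gives the upper bound for \<open>G\<close>; together with the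
  matching lower bound for \<open>K\<^bsub>d,d\<^esub>\<close> it gives the exact volume of the stable set polytope of
  \<open>K\<^bsub>d,d\<^esub>\<close>.
\<close>

section \<open>A discrete Finner inequality\<close>

lemma sum_PiE_insert:
  assumes "v \<notin> V"
  shows "(\<Sum>x\<in>insert v V \<rightarrow>\<^sub>E A. h x) = (\<Sum>x\<in>V \<rightarrow>\<^sub>E A. \<Sum>a\<in>A. h (x(v := a)))"
proof -
  have "(\<Sum>x\<in>insert v V \<rightarrow>\<^sub>E A. h x) = (\<Sum>(a, x)\<in>A \<times> (V \<rightarrow>\<^sub>E A). h (x(v := a)))"
    unfolding PiE_insert_eq
    by (subst sum.reindex[OF inj_combinator[OF assms]]) (simp add: o_def case_prod_unfold)
  also have "\<dots> = (\<Sum>a\<in>A. \<Sum>x\<in>V \<rightarrow>\<^sub>E A. h (x(v := a)))"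
    by (simp add: sum.cartesian_product)
  also have "\<dots> = (\<Sum>x\<in>V \<rightarrow>\<^sub>E A. \<Sum>a\<in>A. h (x(v := a)))"
    by (rule sum.swap)
  finally show ?thesis .
qed

text \<open>
  Hoelder's inequality for \<open>card J\<close> functions with equal exponents.  After scaling each function
  to norm 1, the product is bounded pointwise by the arithmetic mean of the \<open>card J\<close>-th
  powers, and each of these powers sums to 1.
\<close>

lemma sum_prod_le_prod_root:
  fixes h :: "'j \<Rightarrow> 'a \<Rightarrow> real"
  assumes J: "finite J" "J \<noteq> {}" and A: "finite A"
    and nonneg: "\<And>j a. j \<in> J \<Longrightarrow> a \<in> A \<Longrightarrow> h j a \<ge> 0"
  shows "(\<Sum>a\<in>A. \<Prod>j\<in>J. h j a) \<le> (\<Prod>j\<in>J. root (card J) (\<Sum>a\<in>A. h j a ^ card J))"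
proof -
  define d where "d = card J"
  define s where "s j = (\<Sum>a\<in>A. h j a ^ d)" for j
  have d: "d > 0"
    using J by (auto simp: d_def card_gt_0_iff)
  have s0: "s j \<ge> 0" if "j \<in> J" for j
    unfolding s_def by (intro sum_nonneg zero_le_power nonneg that)
  show ?thesis
  proof (cases "\<exists>j\<in>J. s j = 0")
    case True
    then obtain j where j: "j \<in> J" "s j = 0" by blast
    then have "h j a = 0" if "a \<in> A" for a
      using sum_nonneg_eq_0_iff[of A "\<lambda>a. h j a ^ d"] A nonneg d that by (auto simp: s_def)
    then have "(\<Sum>a\<in>A. \<Prod>j\<in>J. h j a) = 0"
      using j(1) J(1) by (intro sum.neutral) (auto intro: prod_zero)
    moreover have "(\<Prod>j\<in>J. root d (s j)) \<ge> 0"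
      by (intro prod_nonneg) (simp add: s0 d)
    ultimately show ?thesis
      by (simp add: s_def d_def)
  next
    case False
    then have spos: "s j > 0" if "j \<in> J" for j
      using s0[OF that] that by (metis less_eq_real_def)
    define P where "P = (\<Prod>j\<in>J. root d (s j))"
    have P: "P > 0"
      unfolding P_def by (intro prod_pos) (simp add: spos d)
    have "(\<Prod>j\<in>J. h j a) / P \<le> (\<Sum>j\<in>J. (h j a ^ d / s j) / d)" if a: "a \<in> A" for a
    proof -
      let ?u = "\<lambda>j. h j a / root d (s j)"
      have u: "?u j \<ge> 0" if "j \<in> J" for j
        using nonneg[OF that a] s0[OF that] d by simp
      have ud: "?u j ^ d = h j a ^ d / s j" if "j \<in> J" for j
        using s0[OF that] d by (simp add: power_divide)
      have "(\<Prod>j\<in>J. h j a) / P = (\<Prod>j\<in>J. ?u j)"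
        by (simp add: P_def prod_dividef)
      also have "\<dots> = root d ((\<Prod>j\<in>J. ?u j) ^ d)"
        using d by (simp add: real_root_power_cancel prod_nonneg u)
      also have "\<dots> = (\<Prod>j\<in>J. ?u j ^ d) powr (1 / d)"
        using d by (simp add: root_powr_inverse prod_nonneg u prod_power_distrib)
      also have "\<dots> \<le> (\<Sum>j\<in>J. ?u j ^ d / d)"
        unfolding d_def by (rule arith_geom_mean) (use J u in \<open>auto simp: d_def\<close>)
      also have "\<dots> = (\<Sum>j\<in>J. (h j a ^ d / s j) / d)"
        by (intro sum.cong refl) (simp only: ud)
      finally show ?thesis .
    qed
    then have "(\<Sum>a\<in>A. (\<Prod>j\<in>J. h j a) / P) \<le> (\<Sum>a\<in>A. \<Sum>j\<in>J. (h j a ^ d / s j) / d)"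
      by (rule sum_mono)
    also have "\<dots> = (\<Sum>j\<in>J. \<Sum>a\<in>A. (h j a ^ d / s j) / d)"
      by (rule sum.swap)
    also have "\<dots> = (\<Sum>j\<in>J. (s j / s j) / d)"
      by (simp only: s_def sum_divide_distrib)
    also have "\<dots> = (\<Sum>j\<in>J. 1 / d)"
      by (intro sum.cong refl) (use spos in force)
    also have "\<dots> = 1"
      using d by (simp add: d_def)
    finally have "(\<Sum>a\<in>A. \<Prod>j\<in>J. h j a) \<le> P"
      using P by (simp add: sum_divide_distrib[symmetric] field_simps)
    then show ?thesis
      by (simp add: P_def s_def d_def)
  qed
qed

text \<open>
  The generalised Hoelder inequality for functions that depend on overlapping groups of
  coordinates covering each coordinate exactly \<open>d\<close> times.  Coordinates are summed out one at a
  time: summing over coordinate \<open>v\<close> involves exactly \<open>d\<close> of the functions, to which Hoelder's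
  inequality applies, and the resulting norms are again functions of the remaining coordinates.
\<close>

lemma finner_sum:
  fixes f :: "'j \<Rightarrow> ('v \<Rightarrow> 'a) \<Rightarrow> real"
  assumes "finite V" and J: "finite J" and A: "finite A" and d: "d > 0"
    and "\<And>j. j \<in> J \<Longrightarrow> S j \<subseteq> V"
    and "\<And>v. v \<in> V \<Longrightarrow> card {j \<in> J. v \<in> S j} = d"
    and "\<And>j x. j \<in> J \<Longrightarrow> f j x \<ge> 0"
    and "\<And>j x y. j \<in> J \<Longrightarrow> (\<And>v. v \<in> S j \<Longrightarrow> x v = y v) \<Longrightarrow> f j x = f j y"
  shows "(\<Sum>x\<in>V \<rightarrow>\<^sub>E A. \<Prod>j\<in>J. f j x) \<le> (\<Prod>j\<in>J. root d (\<Sum>x\<in>S j \<rightarrow>\<^sub>E A. f j x ^ d))"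
  using assms(1,5-)
proof (induction V arbitrary: S f rule: finite_induct)
  case empty
  have "root d (\<Sum>x\<in>S j \<rightarrow>\<^sub>E A. f j x ^ d) = f j (\<lambda>_. undefined)" if "j \<in> J" for j
  proof -
    have "S j = {}"
      using empty(1)[OF that] by blast
    then show ?thesis
      using empty(3)[OF that] d by (simp add: real_root_power_cancel)
  qed
  then show ?case
    by simp
next
  case (insert v V)
  note depends = insert.prems(4)
  define Jv where "Jv = {j \<in> J. v \<in> S j}"
  \<comment> \<open>What remains of each function once coordinate \<open>v\<close> has been summed out.\<close>
  define f' where
    "f' j x = (if v \<in> S j then root d (\<Sum>a\<in>A. f j (x(v := a)) ^ d) else f j x)" for j x
  have Jv: "finite Jv" "Jv \<subseteq> J" "card Jv = d"
    using J insert.prems(2)[of v] by (simp_all add: Jv_def)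
  then have Jv_ne: "Jv \<noteq> {}"
    using d by auto
  have outside: "f j (x(v := a)) = f j x" if "j \<in> J" "v \<notin> S j" for j x a
    using that by (intro depends) auto
  have "(\<Sum>x\<in>insert v V \<rightarrow>\<^sub>E A. \<Prod>j\<in>J. f j x)
      = (\<Sum>x\<in>V \<rightarrow>\<^sub>E A. \<Sum>a\<in>A. \<Prod>j\<in>J. f j (x(v := a)))"
    by (rule sum_PiE_insert[OF insert.hyps(2)])
  also have "\<dots> \<le> (\<Sum>x\<in>V \<rightarrow>\<^sub>E A. \<Prod>j\<in>J. f' j x)"
  proof (rule sum_mono)
    fix x
    have "(\<Sum>a\<in>A. \<Prod>j\<in>J. f j (x(v := a)))
        = (\<Sum>a\<in>A. (\<Prod>j\<in>J - Jv. f' j x) * (\<Prod>j\<in>Jv. f j (x(v := a))))"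
    proof (rule sum.cong[OF refl])
      fix a
      have "(\<Prod>j\<in>J. f j (x(v := a)))
          = (\<Prod>j\<in>J - Jv. f j (x(v := a))) * (\<Prod>j\<in>Jv. f j (x(v := a)))"
        by (rule prod.subset_diff[OF Jv(2) J])
      also have "(\<Prod>j\<in>J - Jv. f j (x(v := a))) = (\<Prod>j\<in>J - Jv. f' j x)"
        by (rule prod.cong) (auto simp: Jv_def f'_def outside)
      finally show "(\<Prod>j\<in>J. f j (x(v := a)))
          = (\<Prod>j\<in>J - Jv. f' j x) * (\<Prod>j\<in>Jv. f j (x(v := a)))" .
    qed
    also have "\<dots> = (\<Prod>j\<in>J - Jv. f' j x) * (\<Sum>a\<in>A. \<Prod>j\<in>Jv. f j (x(v := a)))"
      by (rule sum_distrib_left[symmetric])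
    also have "\<dots> \<le> (\<Prod>j\<in>J - Jv. f' j x) * (\<Prod>j\<in>Jv. f' j x)"
    proof (rule mult_left_mono)
      have "(\<Sum>a\<in>A. \<Prod>j\<in>Jv. f j (x(v := a)))
          \<le> (\<Prod>j\<in>Jv. root (card Jv) (\<Sum>a\<in>A. f j (x(v := a)) ^ card Jv))"
        by (rule sum_prod_le_prod_root) (use Jv Jv_ne A insert.prems(3) in auto)
      also have "\<dots> = (\<Prod>j\<in>Jv. f' j x)"
        unfolding Jv(3) by (rule prod.cong) (auto simp: f'_def Jv_def)
      finally show "(\<Sum>a\<in>A. \<Prod>j\<in>Jv. f j (x(v := a))) \<le> (\<Prod>j\<in>Jv. f' j x)" .
      show "0 \<le> (\<Prod>j\<in>J - Jv. f' j x)"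
        by (rule prod_nonneg) (auto simp: f'_def Jv_def insert.prems(3))
    qed
    also have "\<dots> = (\<Prod>j\<in>J. f' j x)"
      by (rule prod.subset_diff[OF Jv(2) J, symmetric])
    finally show "(\<Sum>a\<in>A. \<Prod>j\<in>J. f j (x(v := a))) \<le> (\<Prod>j\<in>J. f' j x)" .
  qed
  also have "\<dots> \<le> (\<Prod>j\<in>J. root d (\<Sum>x\<in>(S j - {v}) \<rightarrow>\<^sub>E A. f' j x ^ d))"
  proof (rule insert.IH)
    show "S j - {v} \<subseteq> V" if "j \<in> J" for j
      using insert.prems(1)[OF that] by blast
    show "card {j \<in> J. w \<in> S j - {v}} = d" if "w \<in> V" for w
    proof -
      have "w \<noteq> v"
        using that insert.hyps(2) by blast
      then show ?thesis
        using insert.prems(2)[of w] that by simp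
    qed
    show "f' j x \<ge> 0" if "j \<in> J" for j x
      using insert.prems(3)[OF that] d by (simp add: f'_def sum_nonneg)
    show "f' j x = f' j y" if "j \<in> J" "\<And>w. w \<in> S j - {v} \<Longrightarrow> x w = y w" for j x y
    proof (cases "v \<in> S j")
      case True
      have "f j (x(v := a)) = f j (y(v := a))" for a
        by (rule depends) (use that in auto)
      with True show ?thesis
        by (simp add: f'_def)
    next
      case False
      then show ?thesis
        using that by (auto simp: f'_def intro!: depends)
    qed
  qed
  also have "\<dots> = (\<Prod>j\<in>J. root d (\<Sum>x\<in>S j \<rightarrow>\<^sub>E A. f j x ^ d))"
  proof (rule prod.cong[OF refl])
    fix j assume j: "j \<in> J"
    have "(\<Sum>x\<in>(S j - {v}) \<rightarrow>\<^sub>E A. f' j x ^ d) = (\<Sum>x\<in>S j \<rightarrow>\<^sub>E A. f j x ^ d)"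
    proof (cases "v \<in> S j")
      case True
      then have "(\<Sum>x\<in>S j \<rightarrow>\<^sub>E A. f j x ^ d)
          = (\<Sum>x\<in>(S j - {v}) \<rightarrow>\<^sub>E A. \<Sum>a\<in>A. f j (x(v := a)) ^ d)"
        using sum_PiE_insert[of v "S j - {v}"] by (simp add: insert_absorb)
      also have "\<dots> = (\<Sum>x\<in>(S j - {v}) \<rightarrow>\<^sub>E A. f' j x ^ d)"
        using True d insert.prems(3)[OF j]
        by (intro sum.cong refl) (simp add: f'_def sum_nonneg)
      finally show ?thesis ..
    qed (simp add: f'_def)
    then show "root d (\<Sum>x\<in>(S j - {v}) \<rightarrow>\<^sub>E A. f' j x ^ d) = root d (\<Sum>x\<in>S j \<rightarrow>\<^sub>E A. f j x ^ d)"
      by simp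
  qed
  finally show ?case .
qed

section \<open>Threshold labelings and bipartite swapping\<close>

definition threshold_labelings :: "'a set \<Rightarrow> ('a \<times> 'a) set \<Rightarrow> nat \<Rightarrow> ('a \<Rightarrow> nat) set" where
  "threshold_labelings V E m = {k \<in> V \<rightarrow>\<^sub>E {..m}. \<forall>(u, v)\<in>E. k u + k v \<le> m}"

text \<open>
  For a symmetric \<open>E\<close> these are the threshold labelings of the bipartite double cover of the
  graph, \<open>x\<close> labelling one copy of the vertex set and \<open>y\<close> the other.
\<close>

definition crossed_labelings ::
    "'a set \<Rightarrow> ('a \<times> 'a) set \<Rightarrow> nat \<Rightarrow> (('a \<Rightarrow> nat) \<times> ('a \<Rightarrow> nat)) set" where
  "crossed_labelings V E m =
     {(x, y). x \<in> V \<rightarrow>\<^sub>E {..m} \<and> y \<in> V \<rightarrow>\<^sub>E {..m} \<and> (\<forall>(u, v)\<in>E. x u + y v \<le> m)}"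

lemma finite_threshold_labelings: "finite V \<Longrightarrow> finite (threshold_labelings V E m)"
  unfolding threshold_labelings_def by (simp add: finite_PiE)

lemma finite_crossed_labelings:
  assumes "finite V"
  shows "finite (crossed_labelings V E m)"
proof (rule finite_subset)
  show "crossed_labelings V E m \<subseteq> (V \<rightarrow>\<^sub>E {..m}) \<times> (V \<rightarrow>\<^sub>E {..m})"
    by (auto simp: crossed_labelings_def)
qed (use assms in \<open>simp add: finite_PiE\<close>)

definition swap_on :: "'a set \<Rightarrow> ('a \<Rightarrow> 'b) \<times> ('a \<Rightarrow> 'b) \<Rightarrow> ('a \<Rightarrow> 'b) \<times> ('a \<Rightarrow> 'b)" where
  "swap_on W p = ((\<lambda>v. if v \<in> W then snd p v else fst p v), (\<lambda>v. if v \<in> W then fst p v else snd p v))"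

lemma swap_on_swap_on: "swap_on W (swap_on W p) = p"
  by (cases p) (auto simp: swap_on_def)

text \<open>
  The edges on which some combination of the labels offered by the pair violates the threshold.
  All four combinations are considered, so that swapping the two labels of a vertex
  does not change the set.
\<close>

definition conflict_edges ::
    "('a \<times> 'a) set \<Rightarrow> nat \<Rightarrow> ('a \<Rightarrow> nat) \<times> ('a \<Rightarrow> nat) \<Rightarrow> ('a \<times> 'a) set" where
  "conflict_edges E m p =
     {(u, v)\<in>E. \<exists>i\<in>{fst p u, snd p u}. \<exists>j\<in>{fst p v, snd p v}. m < i + j}"

lemma conflict_edges_swap_on: "conflict_edges E m (swap_on W p) = conflict_edges E m p"
  by (auto simp: conflict_edges_def swap_on_def split: if_splits)

text \<open>
  If \<open>x\<close> and \<open>y\<close> are threshold labelings and \<open>(u, v)\<close> is a conflict edge, then \<open>x u + y v > m\<close> or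
  \<open>y u + x v > m\<close>, while \<open>x u + x v\<close> and \<open>y u + y v\<close> are at most \<open>m\<close>.  In the first case
  \<open>y v > x v\<close> and \<open>x u > y u\<close>, and the second is symmetric.  So every conflict edge joins a vertex
  with \<open>x > y\<close> to one with \<open>x < y\<close>, and some set of vertices contains exactly one end of each
  conflict edge.  Swapping \<open>x\<close> and \<open>y\<close> on such a set turns the pair into a crossed labeling.
  The set is chosen as a function of the conflict edges alone; these survive the swap, so the
  swap can be undone and the map is injective.
\<close>

lemma card_threshold_labelings_squared_le:
  assumes V: "finite V" and E: "E \<subseteq> V \<times> V"
  shows "card (threshold_labelings V E m) ^ 2 \<le> card (crossed_labelings V E m)"
proof -
  let ?L = "threshold_labelings V E m"
  define separates :: "'a set \<Rightarrow> ('a \<times> 'a) set \<Rightarrow> bool" where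
    "separates W B \<longleftrightarrow> (\<forall>(u, v)\<in>B. (u \<in> W) \<noteq> (v \<in> W))" for W B
  define cut where "cut B = (SOME W. separates W B)" for B
  define f where "f p = swap_on (cut (conflict_edges E m p)) p" for p
  have cut: "separates (cut (conflict_edges E m p)) (conflict_edges E m p)"
    if "p \<in> ?L \<times> ?L" for p
    unfolding cut_def
  proof (rule someI)
    show "separates {v. fst p v > snd p v} (conflict_edges E m p)"
      using that by (fastforce simp: separates_def conflict_edges_def threshold_labelings_def)
  qed
  have "inj_on f (?L \<times> ?L)"
  proof (rule inj_onI)
    fix p q assume "f p = f q"
    moreover from this have "conflict_edges E m p = conflict_edges E m q"
      unfolding f_def by (metis conflict_edges_swap_on)
    ultimately show "p = q"
      unfolding f_def by (metis swap_on_swap_on)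
  qed
  moreover have "f ` (?L \<times> ?L) \<subseteq> crossed_labelings V E m"
  proof (rule image_subsetI)
    fix p assume "p \<in> ?L \<times> ?L"
    then obtain x y where p: "p = (x, y)" and xy: "x \<in> ?L" "y \<in> ?L"
      by blast
    define W where "W = cut (conflict_edges E m (x, y))"
    have sep: "separates W (conflict_edges E m (x, y))"
      unfolding W_def by (rule cut) (use xy in simp)
    have "fst (swap_on W (x, y)) u + snd (swap_on W (x, y)) v \<le> m" if uv: "(u, v) \<in> E" for u v
    proof (cases "(u, v) \<in> conflict_edges E m (x, y)")
      case True
      then have "(u \<in> W) \<noteq> (v \<in> W)"
        using sep by (auto simp: separates_def)
      then show ?thesis
        using xy uv by (auto simp: swap_on_def threshold_labelings_def)
    next
      case False
      then show ?thesis
        using uv by (auto simp: conflict_edges_def swap_on_def)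
    qed
    moreover have "fst (swap_on W (x, y)) \<in> V \<rightarrow>\<^sub>E {..m}" "snd (swap_on W (x, y)) \<in> V \<rightarrow>\<^sub>E {..m}"
      using xy by (auto simp: swap_on_def threshold_labelings_def PiE_iff extensional_def)
    ultimately show "f p \<in> crossed_labelings V E m"
      by (auto simp: p f_def crossed_labelings_def W_def[symmetric] case_prod_unfold)
  qed
  ultimately have "card (?L \<times> ?L) \<le> card (crossed_labelings V E m)"
    by (metis card_inj_on_le finite_crossed_labelings[OF V])
  then show ?thesis
    by (simp add: power2_eq_square card_cartesian_product)
qed

section \<open>Counting crossed labelings\<close>

definition headroom :: "nat \<Rightarrow> 'a set \<Rightarrow> ('a \<Rightarrow> nat) \<Rightarrow> nat" where
  "headroom m S x = card {j \<in> {..m}. \<forall>u\<in>S. x u + j \<le> m}"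

lemma card_crossed_labelings:
  assumes V: "finite V" and E: "E \<subseteq> V \<times> V"
  shows "card (crossed_labelings V E m) = (\<Sum>x\<in>V \<rightarrow>\<^sub>E {..m}. \<Prod>v\<in>V. headroom m {u. (u, v) \<in> E} x)"
proof -
  have "crossed_labelings V E m
      = (SIGMA x:(V \<rightarrow>\<^sub>E {..m}). (\<Pi>\<^sub>E v\<in>V. {j \<in> {..m}. \<forall>u\<in>{u. (u, v) \<in> E}. x u + j \<le> m}))"
    (is "_ = Sigma ?X ?Y")
  proof (intro set_eqI iffI; clarify)
    fix x y assume "(x, y) \<in> crossed_labelings V E m"
    then show "x \<in> ?X \<and> y \<in> ?Y x"
      by (auto simp: crossed_labelings_def PiE_iff)
  next
    fix x y assume xy: "x \<in> ?X" "y \<in> ?Y x"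
    have "x u + y v \<le> m" if "(u, v) \<in> E" for u v
    proof -
      have "v \<in> V"
        using that E by blast
      then have "y v \<in> {j \<in> {..m}. \<forall>u\<in>{u. (u, v) \<in> E}. x u + j \<le> m}"
        using xy(2) by (rule PiE_mem[rotated])
      then show ?thesis
        using that by blast
    qed
    then show "(x, y) \<in> crossed_labelings V E m"
      using xy by (auto simp: crossed_labelings_def PiE_iff)
  qed
  then have "card (crossed_labelings V E m) = (\<Sum>x\<in>?X. card (?Y x))"
    using V by (simp add: card_SigmaI finite_PiE)
  also have "\<dots> = (\<Sum>x\<in>?X. \<Prod>v\<in>V. headroom m {u. (u, v) \<in> E} x)"
    by (simp only: card_PiE[OF V] headroom_def)
  finally show ?thesis .
qed

text \<open>
  The number of threshold labelings of \<open>K\<^bsub>d,d\<^esub>\<close>: \<open>(j + 1) ^ d - j ^ d\<close> labelings of one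
  side have maximum \<open>j\<close>, and each leaves \<open>m + 1 - j\<close> labels for every vertex of the other side.
\<close>

definition Kdd_count :: "nat \<Rightarrow> nat \<Rightarrow> real" where
  "Kdd_count d m = (\<Sum>j\<le>m. (real (Suc j) ^ d - real j ^ d) * real (Suc m - j) ^ d)"

text \<open>
  Writing the \<open>d\<close>-th power of the headroom as a telescoping sum over the available labels \<open>j\<close> and
  exchanging the sums leaves, for each \<open>j\<close>, the labelings of \<open>S\<close> with values in \<open>{..m - j}\<close>.
\<close>

lemma sum_headroom_power:
  assumes S: "finite S" "card S = d" and d: "d > 0"
  shows "(\<Sum>z\<in>S \<rightarrow>\<^sub>E {..m}. real (headroom m S z) ^ d) = Kdd_count d m"
proof -
  define D where "D z = {j \<in> {..m}. \<forall>u\<in>S. z u + j \<le> m}" for z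
  define w where "w j = real (Suc j) ^ d - real j ^ d" for j
  have "real (headroom m S z) ^ d = (\<Sum>j\<in>D z. w j)" for z
  proof -
    define n where "n = (LEAST j. j \<notin> D z)"
    have "Suc m \<notin> D z"
      by (simp add: D_def)
    then have n: "n \<notin> D z"
      unfolding n_def by (rule LeastI)
    have "D z = {..<n}"
    proof (intro equalityI subsetI)
      fix j assume "j \<in> D z"
      moreover have "n \<in> D z" if "n \<le> j" "j \<in> D z"
        using that by (fastforce simp: D_def)
      ultimately show "j \<in> {..<n}"
        using n by (meson lessThan_iff not_less)
    next
      fix j assume "j \<in> {..<n}"
      then show "j \<in> D z"
        unfolding n_def using not_less_Least by blast
    qed
    moreover from this have "headroom m S z = n"
      by (simp only: headroom_def D_def[symmetric] card_lessThan)
    ultimately show ?thesis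
      using d sum_lessThan_telescope[of "\<lambda>j. real j ^ d" n] by (simp add: w_def)
  qed
  then have "(\<Sum>z\<in>S \<rightarrow>\<^sub>E {..m}. real (headroom m S z) ^ d) = (\<Sum>z\<in>S \<rightarrow>\<^sub>E {..m}. \<Sum>j\<in>D z. w j)"
    by simp
  also have "\<dots> = (\<Sum>j\<le>m. \<Sum>z | z \<in> S \<rightarrow>\<^sub>E {..m} \<and> (\<forall>u\<in>S. z u + j \<le> m). w j)"
    unfolding D_def by (rule sum.swap_restrict) (simp_all add: finite_PiE S)
  also have "\<dots> = (\<Sum>j\<le>m. w j * real (Suc m - j) ^ d)"
  proof (rule sum.cong[OF refl])
    fix j assume j: "j \<in> {..m}"
    then have "i \<le> m - j \<longleftrightarrow> i \<le> m \<and> i + j \<le> m" for i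
      by auto
    then have "{z. z \<in> S \<rightarrow>\<^sub>E {..m} \<and> (\<forall>u\<in>S. z u + j \<le> m)} = S \<rightarrow>\<^sub>E {..m - j}"
      by (auto simp: PiE_iff extensional_def)
    then show "(\<Sum>z | z \<in> S \<rightarrow>\<^sub>E {..m} \<and> (\<forall>u\<in>S. z u + j \<le> m). w j) = w j * real (Suc m - j) ^ d"
      using S j by (simp add: card_funcsetE Suc_diff_le)
  qed
  finally show ?thesis
    by (simp add: Kdd_count_def w_def)
qed

text \<open>
  The Finner inequality, applied to the neighbourhoods: the number of sets that cover
  a vertex is its degree, and so is the size of each set, which makes
  every factor on the right equal to the same power sum of headrooms.
\<close>

lemma card_crossed_labelings_le:
  assumes V: "finite V" and E: "E \<subseteq> V \<times> V" and d: "d > 0"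
    and outdeg: "\<And>u. u \<in> V \<Longrightarrow> card {v. (u, v) \<in> E} = d"
    and indeg: "\<And>v. v \<in> V \<Longrightarrow> card {u. (u, v) \<in> E} = d"
  shows "real (card (crossed_labelings V E m)) \<le> root d (Kdd_count d m) ^ card V"
proof -
  let ?S = "\<lambda>v. {u. (u, v) \<in> E}"
  have fin: "finite (?S v)" if "v \<in> V" for v
    by (rule finite_subset[OF _ V]) (use E in auto)
  have "real (card (crossed_labelings V E m))
      = (\<Sum>x\<in>V \<rightarrow>\<^sub>E {..m}. \<Prod>v\<in>V. real (headroom m (?S v) x))"
    by (simp add: card_crossed_labelings[OF V E])
  also have "\<dots> \<le> (\<Prod>v\<in>V. root d (\<Sum>x\<in>?S v \<rightarrow>\<^sub>E {..m}. real (headroom m (?S v) x) ^ d))"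
  proof (rule finner_sum[OF V V _ d])
    show "card {v \<in> V. u \<in> ?S v} = d" if "u \<in> V" for u
    proof -
      have "{v \<in> V. u \<in> ?S v} = {v. (u, v) \<in> E}"
        using E by auto
      then show ?thesis
        using outdeg[OF that] by simp
    qed
    show "real (headroom m (?S v) x) = real (headroom m (?S v) y)"
      if "\<And>u. u \<in> ?S v \<Longrightarrow> x u = y u" for v x y
      unfolding headroom_def using that by (metis (no_types, lifting))
  qed (use E in auto)
  also have "\<dots> = (\<Prod>v\<in>V. root d (Kdd_count d m))"
    by (rule prod.cong[OF refl]) (simp add: sum_headroom_power[OF fin indeg d])
  finally show ?thesis
    by simp
qed


section \<open>The asymptotic number of threshold labelings of the complete bipartite graph\<close>

text \<open>
  Both sides count the subsets of \<open>{0..n}\<close> with \<open>a + b + 1\<close> elements, the left one according to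
  the element \<open>k\<close> that has exactly \<open>a\<close> smaller elements in the subset.
\<close>

lemma sum_choose_mult_choose:
  "(\<Sum>k\<le>n. (k choose a) * ((n - k) choose b)) = Suc n choose Suc (a + b)"
proof (induction n arbitrary: b)
  case 0
  show ?case
    by (cases a; cases b) simp_all
next
  case (Suc n)
  show ?case
  proof (cases b)
    case 0
    then show ?thesis
      using sum_choose_upper[of a "Suc n"] by simp
  next
    case (Suc c)
    have "(\<Sum>k\<le>Suc n. (k choose a) * ((Suc n - k) choose b))
        = (\<Sum>k\<le>n. (k choose a) * (Suc (n - k) choose Suc c))"
      by (simp add: Suc Suc_diff_le cong: sum.cong_simp)
    also have "\<dots> = (\<Sum>k\<le>n. (k choose a) * ((n - k) choose c))
        + (\<Sum>k\<le>n. (k choose a) * ((n - k) choose Suc c))"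
      by (simp add: sum.distrib distrib_left)
    also have "\<dots> = Suc (Suc n) choose Suc (a + b)"
      by (simp only: Suc.IH) (simp add: Suc)
    finally show ?thesis .
  qed
qed

lemma power_le_fact_times_choose: "Suc k ^ r \<le> fact r * ((k + r) choose r)"
proof (induction r)
  case (Suc r)
  have "Suc k ^ Suc r \<le> Suc (k + r) * (fact r * ((k + r) choose r))"
    using mult_mono[OF _ Suc.IH, of "Suc k" "Suc (k + r)"] by simp
  also have "\<dots> = fact r * (Suc (k + r) * ((k + r) choose r))"
    by (simp only: mult.left_commute)
  also have "Suc (k + r) * ((k + r) choose r) = (Suc (k + r) choose Suc r) * Suc r"
    by (rule Suc_times_binomial_eq)
  finally show ?case
    by (simp add: algebra_simps)
qed simp

lemma power_Suc_diff_bounds: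
  shows "real (Suc e) * real j ^ e \<le> real (Suc j) ^ Suc e - real j ^ Suc e"
    and "real (Suc j) ^ Suc e - real j ^ Suc e \<le> real (Suc e) * real (Suc j) ^ e"
proof -
  have eq: "real (Suc j) ^ Suc e - real j ^ Suc e = (\<Sum>p<Suc e. real (Suc j) ^ p * real j ^ (e - p))"
    by (subst diff_power_eq_sum) simp
  have "(\<Sum>p<Suc e. real (Suc j) ^ p * real j ^ (e - p)) \<ge> (\<Sum>p<Suc e. real j ^ p * real j ^ (e - p))"
    by (intro sum_mono mult_right_mono power_mono) auto
  also have "(\<Sum>p<Suc e. real j ^ p * real j ^ (e - p)) = (\<Sum>p<Suc e. real j ^ e)"
    by (intro sum.cong refl) (simp flip: power_add)
  finally show "real (Suc e) * real j ^ e \<le> real (Suc j) ^ Suc e - real j ^ Suc e"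
    unfolding eq by simp
  have "(\<Sum>p<Suc e. real (Suc j) ^ p * real j ^ (e - p))
      \<le> (\<Sum>p<Suc e. real (Suc j) ^ p * real (Suc j) ^ (e - p))"
    by (intro sum_mono mult_left_mono power_mono) auto
  also have "\<dots> = (\<Sum>p<Suc e. real (Suc j) ^ e)"
    by (intro sum.cong refl) (simp flip: power_add)
  finally show "real (Suc j) ^ Suc e - real j ^ Suc e \<le> real (Suc e) * real (Suc j) ^ e"
    unfolding eq by simp
qed

text \<open>
  Each summand of \<open>Kdd_count\<close> is, up to lower order terms, \<open>d * j ^ (d - 1) * (m - j) ^ d\<close>.
  Replacing these powers by falling factorials (from below) or rising factorials (from above)
  turns the sum into a convolution of binomial coefficients, which is evaluated exactly.
\<close>

lemma Kdd_count_bounds_choose: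
  assumes "d > 0"
  shows "fact d ^ 2 * real ((m + 2) choose (2 * d)) \<le> Kdd_count d m"
    and "Kdd_count d m \<le> fact d ^ 2 * real ((m + 2 * d) choose (2 * d))"
proof -
  obtain e where e: "d = Suc e"
    using assms by (cases d) auto
  have e2: "Suc (e + d) = 2 * d" "Suc (m + e + d) = m + 2 * d"
    by (simp_all add: e)
  have fact_d: "fact d = real d * fact e"
    by (simp add: e)
  have choose_le: "fact r * real (n choose r) \<le> real n ^ r" for n r
    using binomial_fact_pow[of n r] of_nat_mono[where 'a = real]
    by (metis of_nat_mult of_nat_fact of_nat_power mult.commute)
  have le_choose: "real (Suc k) ^ r \<le> fact r * real ((k + r) choose r)" for k r
    using power_le_fact_times_choose[of k r] of_nat_mono[where 'a = real]
    by (metis of_nat_mult of_nat_fact of_nat_power)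

  \<comment> \<open>The convolution runs up to \<open>Suc m\<close>, but its last term contains the factor \<open>0 choose d\<close>.\<close>
  have "(\<Sum>j\<le>m. (j choose e) * ((Suc m - j) choose d)) = Suc (Suc m) choose Suc (e + d)"
    using sum_choose_mult_choose[of e "Suc m" d] binomial_eq_0[OF assms]
    by (simp del: binomial_Suc_Suc)
  then have "fact d ^ 2 * real ((m + 2) choose (2 * d))
      = fact d ^ 2 * real (\<Sum>j\<le>m. (j choose e) * ((Suc m - j) choose d))"
    by (simp add: e2 del: binomial_Suc_Suc)
  also have "\<dots> = (\<Sum>j\<le>m. (fact d * real (j choose e)) * (fact d * real ((Suc m - j) choose d)))"
    by (simp add: sum_distrib_left power2_eq_square ac_simps)
  also have "\<dots> \<le> Kdd_count d m"
    unfolding Kdd_count_def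
  proof (intro sum_mono mult_mono choose_le)
    fix j
    have "fact d * real (j choose e) \<le> real d * real j ^ e"
      using mult_left_mono[OF choose_le[of e j], of "real d"] by (simp add: fact_d mult.assoc)
    also have "\<dots> \<le> real (Suc j) ^ d - real j ^ d"
      using power_Suc_diff_bounds(1)[of e j] by (simp only: e)
    finally show "fact d * real (j choose e) \<le> real (Suc j) ^ d - real j ^ d" .
    then show "0 \<le> real (Suc j) ^ d - real j ^ d"
      by (smt (verit) fact_ge_zero mult_nonneg_nonneg of_nat_0_le_iff)
  qed simp
  finally show "fact d ^ 2 * real ((m + 2) choose (2 * d)) \<le> Kdd_count d m" .

  have "Kdd_count d m
      \<le> (\<Sum>j\<le>m. (fact d * real ((j + e) choose e)) * (fact d * real ((m - j + d) choose d)))"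
    unfolding Kdd_count_def
  proof (intro sum_mono mult_mono)
    fix j assume j: "j \<in> {..m}"
    have "real (Suc j) ^ d - real j ^ d \<le> real d * real (Suc j) ^ e"
      using power_Suc_diff_bounds(2)[of j e] by (simp only: e)
    also have "\<dots> \<le> fact d * real ((j + e) choose e)"
      using mult_left_mono[OF le_choose[of j e], of "real d"] by (simp add: fact_d mult.assoc)
    finally show "real (Suc j) ^ d - real j ^ d \<le> fact d * real ((j + e) choose e)" .
    show "real (Suc m - j) ^ d \<le> fact d * real ((m - j + d) choose d)"
      using le_choose[of "m - j" d] j by (simp add: Suc_diff_le)
  qed simp_all
  also have "\<dots> = fact d ^ 2 * real (\<Sum>j\<le>m. ((j + e) choose e) * ((m - j + d) choose d))"
    by (simp add: sum_distrib_left power2_eq_square ac_simps)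
  also have "\<dots> \<le> fact d ^ 2 * real (\<Sum>k\<le>m + e + d. (k choose e) * ((m + e + d - k) choose d))"
  proof (intro mult_left_mono of_nat_mono)
    have "(\<Sum>j\<le>m. ((j + e) choose e) * ((m - j + d) choose d))
        = (\<Sum>j\<le>m. ((j + e) choose e) * ((m + e + d - (j + e)) choose d))"
      by (intro sum.cong refl) simp
    also have "\<dots> = (\<Sum>k\<in>(\<lambda>j. j + e) ` {..m}. (k choose e) * ((m + e + d - k) choose d))"
      by (simp add: sum.reindex)
    also have "\<dots> \<le> (\<Sum>k\<le>m + e + d. (k choose e) * ((m + e + d - k) choose d))"
      by (rule sum_mono2) auto
    finally show "(\<Sum>j\<le>m. ((j + e) choose e) * ((m - j + d) choose d))
        \<le> (\<Sum>k\<le>m + e + d. (k choose e) * ((m + e + d - k) choose d))" .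
  qed simp
  also have "\<dots> = fact d ^ 2 * real ((m + 2 * d) choose (2 * d))"
    by (simp only: sum_choose_mult_choose e2)
  finally show "Kdd_count d m \<le> fact d ^ 2 * real ((m + 2 * d) choose (2 * d))" .
qed

lemma Kdd_count_bounds:
  assumes "d > 0"
  shows "real (m + 2 - 2 * d) ^ (2 * d) / real ((2 * d) choose d) \<le> Kdd_count d m"
    and "Kdd_count d m \<le> real (m + 2 * d) ^ (2 * d) / real ((2 * d) choose d)"
proof -
  have "fact d * fact d * ((2 * d) choose d) = (fact (2 * d) :: nat)"
    using binomial_fact_lemma[of d "2 * d"] by (simp add: mult_2)
  then have "real (fact d * fact d * ((2 * d) choose d)) = real (fact (2 * d))"
    by simp
  then have central: "fact d ^ 2 * real ((2 * d) choose d) = fact (2 * d)"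
    by (simp add: power2_eq_square)
  have pos: "real ((2 * d) choose d) > 0"
    by simp
  have "real (m + 2 - 2 * d) ^ (2 * d) \<le> fact (2 * d) * real ((m + 2) choose (2 * d))"
  proof (cases "2 * d \<le> m + 2")
    case True
    have "(m + 2 - 2 * d) ^ (2 * d) \<le> Suc (m + 2 - 2 * d) ^ (2 * d)"
      by (intro power_mono) auto
    also have "\<dots> \<le> fact (2 * d) * ((m + 2) choose (2 * d))"
      using power_le_fact_times_choose[of "m + 2 - 2 * d" "2 * d"] True by simp
    finally have "real ((m + 2 - 2 * d) ^ (2 * d)) \<le> real (fact (2 * d) * ((m + 2) choose (2 * d)))"
      by (rule of_nat_mono)
    then show ?thesis
      by simp
  next
    case False
    then have "real (m + 2 - 2 * d) ^ (2 * d) = 0"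
      using assms by (simp add: zero_power)
    also have "0 \<le> fact (2 * d) * real ((m + 2) choose (2 * d))"
      by simp
    finally show ?thesis .
  qed
  also have "\<dots> = fact d ^ 2 * real ((m + 2) choose (2 * d)) * real ((2 * d) choose d)"
    by (simp flip: central)
  also have "\<dots> \<le> Kdd_count d m * real ((2 * d) choose d)"
    by (rule mult_right_mono[OF Kdd_count_bounds_choose(1)[OF assms]]) simp
  finally show "real (m + 2 - 2 * d) ^ (2 * d) / real ((2 * d) choose d) \<le> Kdd_count d m"
    using pos by (simp only: pos_divide_le_eq)
  have "Kdd_count d m * real ((2 * d) choose d)
      \<le> fact d ^ 2 * real ((m + 2 * d) choose (2 * d)) * real ((2 * d) choose d)"
    by (rule mult_right_mono[OF Kdd_count_bounds_choose(2)[OF assms]]) simp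
  also have "\<dots> = real (((m + 2 * d) choose (2 * d)) * fact (2 * d))"
    by (simp flip: central)
  also have "\<dots> \<le> real ((m + 2 * d) ^ (2 * d))"
    by (rule of_nat_mono[OF binomial_fact_pow])
  finally show "Kdd_count d m \<le> real (m + 2 * d) ^ (2 * d) / real ((2 * d) choose d)"
    using pos by (simp only: pos_le_divide_eq of_nat_power)
qed

section \<open>Volumes by counting grid cells\<close>

definition edge_polytope :: "'a set \<Rightarrow> ('a \<times> 'a) set \<Rightarrow> ('a \<Rightarrow> real) set" where
  "edge_polytope V E = {x \<in> V \<rightarrow>\<^sub>E {0..1}. \<forall>(u, v)\<in>E. x u + x v \<le> 1}"

definition grid_cell :: "'a set \<Rightarrow> nat \<Rightarrow> ('a \<Rightarrow> nat) \<Rightarrow> ('a \<Rightarrow> real) set" where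
  "grid_cell V m k = (\<Pi>\<^sub>E v\<in>V. {real (k v) / real m ..< (real (k v) + 1) / real m})"

lemma sets_grid_cell: "finite V \<Longrightarrow> grid_cell V m k \<in> sets (PiM V (\<lambda>_. lborel))"
  unfolding grid_cell_def by (rule sets_PiM_I_finite) auto

lemma emeasure_grid_cell:
  assumes "finite V" "m > 0"
  shows "emeasure (PiM V (\<lambda>_. lborel)) (grid_cell V m k) = ennreal (1 / real m ^ card V)"
proof -
  interpret product_sigma_finite "\<lambda>_::'a. lborel :: real measure" ..
  have "emeasure (PiM V (\<lambda>_. lborel)) (grid_cell V m k)
      = (\<Prod>v\<in>V. emeasure lborel {real (k v) / real m ..< (real (k v) + 1) / real m})"
    unfolding grid_cell_def by (rule emeasure_PiM) (use assms in auto)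
  also have "\<dots> = (\<Prod>v\<in>V. ennreal (1 / real m))"
    using assms(2) by (intro prod.cong refl) (simp add: divide_right_mono diff_divide_distrib[symmetric])
  also have "\<dots> = ennreal (1 / real m ^ card V)"
    by (simp add: ennreal_power power_one_over)
  finally show ?thesis .
qed

lemma disjoint_family_grid_cell:
  assumes "m > 0"
  shows "disjoint_family_on (grid_cell V m) (V \<rightarrow>\<^sub>E A)"
  unfolding disjoint_family_on_def
proof (intro ballI impI)
  fix k l assume k: "k \<in> V \<rightarrow>\<^sub>E A" and l: "l \<in> V \<rightarrow>\<^sub>E A" and "k \<noteq> l"
  have "k v = l v" if "x \<in> grid_cell V m k" "x \<in> grid_cell V m l" "v \<in> V" for x v
  proof -
    have "real (k v) / real m \<le> x v" "x v < (real (k v) + 1) / real m"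
      "real (l v) / real m \<le> x v" "x v < (real (l v) + 1) / real m"
      using that by (auto simp: grid_cell_def PiE_iff)
    then have "real (k v) < real (l v) + 1" "real (l v) < real (k v) + 1"
      using assms by (simp_all add: field_simps)
    then show ?thesis
      by linarith
  qed
  then show "grid_cell V m k \<inter> grid_cell V m l = {}"
    using PiE_ext[OF k l] \<open>k \<noteq> l\<close> by blast
qed

lemma emeasure_union_grid_cells:
  assumes V: "finite V" and m: "m > 0" and K: "K \<subseteq> V \<rightarrow>\<^sub>E A" "finite K"
  shows "emeasure (PiM V (\<lambda>_. lborel)) (\<Union>k\<in>K. grid_cell V m k)
    = ennreal (real (card K) / real m ^ card V)"
proof -
  have "emeasure (PiM V (\<lambda>_. lborel)) (\<Union>k\<in>K. grid_cell V m k)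
      = (\<Sum>k\<in>K. emeasure (PiM V (\<lambda>_. lborel)) (grid_cell V m k))"
    by (rule sum_emeasure[symmetric])
      (use sets_grid_cell[OF V] K disjoint_family_on_mono[OF K(1) disjoint_family_grid_cell[OF m]] in auto)
  also have "\<dots> = ennreal (real (card K) / real m ^ card V)"
    by (simp add: emeasure_grid_cell[OF V m] ennreal_of_nat_eq_real_of_nat flip: ennreal_mult)
  finally show ?thesis .
qed

text \<open>
  Rounding down preserves the edge inequalities: the cell containing \<open>x\<close> has the index
  \<open>\<lfloor>m * x v\<rfloor>\<close>, which is a threshold labeling.  The cells are half-open, but no coordinate leaves
  the grid, since index \<open>m\<close> is a permitted label.
\<close>

lemma edge_polytope_subset_union_grid_cells:
  assumes m: "m > 0" and E: "E \<subseteq> V \<times> V"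
  shows "edge_polytope V E \<subseteq> (\<Union>k\<in>threshold_labelings V E m. grid_cell V m k)"
proof
  fix x assume "x \<in> edge_polytope V E"
  then have x: "x \<in> V \<rightarrow>\<^sub>E {0..1}" "\<And>u v. (u, v) \<in> E \<Longrightarrow> x u + x v \<le> 1"
    by (auto simp: edge_polytope_def)
  define k where "k = (\<lambda>v\<in>V. nat \<lfloor>real m * x v\<rfloor>)"
  have kv: "real (k v) \<le> real m * x v" "real m * x v < real (k v) + 1" if "v \<in> V" for v
  proof -
    have "0 \<le> real m * x v"
      using x(1) that by (auto simp: PiE_iff)
    then show "real (k v) \<le> real m * x v" "real m * x v < real (k v) + 1"
      using that by (simp_all add: k_def)
  qed
  have "x \<in> grid_cell V m k"
    using x(1) kv m by (auto simp: grid_cell_def PiE_iff field_simps)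
  moreover have "k \<in> threshold_labelings V E m"
  proof -
    have "k v \<le> m" if "v \<in> V" for v
    proof -
      have "real m * x v \<le> real m * 1"
        by (rule mult_left_mono) (use x(1) that in \<open>auto simp: PiE_iff\<close>)
      then show ?thesis
        using kv(1)[OF that] by linarith
    qed
    moreover have "k u + k v \<le> m" if uv: "(u, v) \<in> E" for u v
    proof -
      have "real m * (x u + x v) \<le> real m * 1"
        by (rule mult_left_mono[OF x(2)[OF uv]]) simp
      moreover have "real (k u) \<le> real m * x u" "real (k v) \<le> real m * x v"
        using kv(1) uv E by auto
      ultimately show ?thesis
        by (simp add: distrib_left)
    qed
    moreover have "k \<in> extensional V"
      by (simp add: k_def)
    ultimately show ?thesis
      by (auto simp: threshold_labelings_def PiE_iff)
  qed
  ultimately show "x \<in> (\<Union>k\<in>threshold_labelings V E m. grid_cell V m k)"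
    by blast
qed

text \<open>
  With cells of side \<open>1 / (m + 2)\<close>, the far corner of a cell exceeds its index by one unit in each
  of the two coordinates of an edge, and the two spare units absorb this.
\<close>

lemma union_grid_cells_subset_edge_polytope:
  assumes E: "E \<subseteq> V \<times> V"
  shows "(\<Union>k\<in>threshold_labelings V E m. grid_cell V (m + 2) k) \<subseteq> edge_polytope V E"
proof (rule UN_least, rule subsetI)
  fix k x assume k: "k \<in> threshold_labelings V E m" and x: "x \<in> grid_cell V (m + 2) k"
  have xv: "real (k v) \<le> real (m + 2) * x v" "real (m + 2) * x v < real (k v) + 1"
    if "v \<in> V" for v
    using x that by (auto simp: grid_cell_def PiE_iff field_simps)
  have "0 \<le> x v \<and> x v \<le> 1" if v: "v \<in> V" for v
  proof -
    have "k v \<le> m"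
      using k v by (auto simp: threshold_labelings_def PiE_iff)
    then have "real (m + 2) * x v < real (m + 2) * 1"
      using xv(2)[OF v] by (simp only: mult_1_right)
    moreover have "real (m + 2) * 0 \<le> real (m + 2) * x v"
      using xv(1)[OF v] by (smt (verit) mult_zero_right of_nat_0_le_iff)
    ultimately show ?thesis
      by (simp only: mult_less_cancel_left_pos mult_le_cancel_left_pos) auto
  qed
  moreover have "x u + x v \<le> 1" if uv: "(u, v) \<in> E" for u v
  proof -
    have "k u + k v \<le> m"
      using k uv by (auto simp: threshold_labelings_def)
    then have "(real (k u) + 1) + (real (k v) + 1) \<le> real (m + 2) * 1"
      by simp
    moreover have "real (m + 2) * x u < real (k u) + 1" "real (m + 2) * x v < real (k v) + 1"
      using xv(2) uv E by auto
    ultimately have "real (m + 2) * x u + real (m + 2) * x v \<le> real (m + 2) * 1"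
      by (meson add_strict_mono less_le_trans less_imp_le)
    then have "real (m + 2) * (x u + x v) \<le> real (m + 2) * 1"
      by (simp only: distrib_left)
    then show ?thesis
      by (rule mult_left_le_imp_le) simp
  qed
  moreover have "x \<in> extensional V"
    using x by (simp add: grid_cell_def PiE_iff)
  ultimately show "x \<in> edge_polytope V E"
    by (auto simp: edge_polytope_def PiE_iff)
qed

lemma sets_edge_polytope:
  assumes V: "finite V" and E: "E \<subseteq> V \<times> V"
  shows "edge_polytope V E \<in> sets (PiM V (\<lambda>_. lborel))"
proof -
  have "finite E"
    by (rule finite_subset[OF E]) (simp add: V)
  let ?M = "PiM V (\<lambda>_. lborel :: real measure)"
  have "(V \<rightarrow>\<^sub>E {0..1::real}) \<in> sets ?M"
    by (rule sets_PiM_I_finite[OF V]) simp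
  moreover have "{x \<in> space ?M. x (fst e) + x (snd e) \<le> 1} \<in> sets ?M" if "e \<in> E" for e
  proof -
    have [measurable]: "(\<lambda>x. x (fst e)) \<in> borel_measurable ?M" "(\<lambda>x. x (snd e)) \<in> borel_measurable ?M"
      using that E measurable_component_singleton[of _ V "\<lambda>_. lborel :: real measure"] by auto
    show ?thesis
      by measurable
  qed
  then have "{x \<in> space ?M. \<forall>e\<in>E. x (fst e) + x (snd e) \<le> 1} \<in> sets ?M"
    by (intro sets.sets_Collect_finite_All \<open>finite E\<close>)
  ultimately have "(V \<rightarrow>\<^sub>E {0..1::real}) \<inter> {x \<in> space ?M. \<forall>e\<in>E. x (fst e) + x (snd e) \<le> 1} \<in> sets ?M"
    by blast
  also have "(V \<rightarrow>\<^sub>E {0..1::real}) \<inter> {x \<in> space ?M. \<forall>e\<in>E. x (fst e) + x (snd e) \<le> 1} = edge_polytope V E"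
    by (auto simp: edge_polytope_def space_PiM PiE_iff extensional_def)
  finally show ?thesis .
qed

text \<open>
  The union of cells that covers the edge polytope is measurable, so the upper bound passes to
  every subset \<open>P\<close> of the edge polytope.  For a general graph, \<open>P\<close> will be the stable set
  polytope.
\<close>

lemma
  assumes V: "finite V" and E: "E \<subseteq> V \<times> V"
  shows measure_edge_polytope_le: "m > 0 \<Longrightarrow> P \<subseteq> edge_polytope V E \<Longrightarrow>
      measure (PiM V (\<lambda>_. lborel)) P \<le> real (card (threshold_labelings V E m)) / real m ^ card V"
    and measure_edge_polytope_ge: "real (card (threshold_labelings V E m)) / real (m + 2) ^ card V
      \<le> measure (PiM V (\<lambda>_. lborel)) (edge_polytope V E)"
proof -
  let ?M = "PiM V (\<lambda>_. lborel :: real measure)"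
  note cells = emeasure_union_grid_cells[OF V _ _ finite_threshold_labelings[OF V, of E]]
  have L: "threshold_labelings V E m \<subseteq> V \<rightarrow>\<^sub>E {..m}" for m
    by (auto simp: threshold_labelings_def)
  have upper: "emeasure ?M P \<le> ennreal (real (card (threshold_labelings V E m)) / real m ^ card V)"
    if "m > 0" "P \<subseteq> edge_polytope V E" for m P
  proof -
    have "P \<subseteq> (\<Union>k\<in>threshold_labelings V E m. grid_cell V m k)"
      using edge_polytope_subset_union_grid_cells[OF that(1) E] that(2) by blast
    then have "emeasure ?M P \<le> emeasure ?M (\<Union>k\<in>threshold_labelings V E m. grid_cell V m k)"
      by (rule emeasure_mono)
        (intro sets.finite_UN finite_threshold_labelings V sets_grid_cell)
    then show ?thesis
      using cells[OF that(1) L] by simp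
  qed
  show "measure ?M P \<le> real (card (threshold_labelings V E m)) / real m ^ card V"
    if "m > 0" "P \<subseteq> edge_polytope V E"
    unfolding measure_def by (rule enn2real_leI) (use upper[OF that] in auto)
  have fin: "emeasure ?M (edge_polytope V E) \<noteq> \<infinity>"
    using upper[of 1 "edge_polytope V E"] by (auto simp: top_unique)
  have "ennreal (real (card (threshold_labelings V E m)) / real (m + 2) ^ card V)
      = emeasure ?M (\<Union>k\<in>threshold_labelings V E m. grid_cell V (m + 2) k)"
    using cells[of "m + 2", OF _ L] by simp
  also have "\<dots> \<le> emeasure ?M (edge_polytope V E)"
    by (rule emeasure_mono[OF union_grid_cells_subset_edge_polytope[OF E] sets_edge_polytope[OF V E]])
  also have "\<dots> = ennreal (measure ?M (edge_polytope V E))"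
    by (rule emeasure_eq_ennreal_measure) (use fin in simp)
  finally show "real (card (threshold_labelings V E m)) / real (m + 2) ^ card V
      \<le> measure ?M (edge_polytope V E)"
    by (simp add: ennreal_le_iff)
qed

section \<open>The stable set polytope and the edge polytope\<close>

lemma convex_on_coordsD:
  assumes "convex_on_coords V C" "x \<in> C" "y \<in> C" "0 \<le> t" "t \<le> 1"
  shows "(\<lambda>i\<in>V. t * x i + (1 - t) * y i) \<in> C"
proof -
  have "\<forall>u\<ge>0. \<forall>v\<ge>0. u + v = 1 \<longrightarrow> (\<lambda>i\<in>V. u * x i + v * y i) \<in> C"
    using assms(1-3) unfolding convex_on_coords_def by blast
  then show ?thesis
    using assms(4,5) by simp
qed

text \<open>
  Induction on the number of fractional coordinates: a point with \<open>0 < y w < 1\<close> is the convex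
  combination, with weights \<open>y w\<close> and \<open>1 - y w\<close>, of the points obtained by rounding \<open>y w\<close> to 1 and
  to 0.
\<close>

lemma cube_in_convex_on_coords:
  assumes C: "convex_on_coords V C" and S: "finite S" "S \<subseteq> V"
    and vert: "\<And>T. T \<subseteq> S \<Longrightarrow> char_vector V T \<in> C"
    and "y \<in> extensional V" "\<And>v. v \<in> S \<Longrightarrow> y v \<in> {0..1}" "\<And>v. v \<in> V - S \<Longrightarrow> y v = 0"
  shows "y \<in> C"
  using assms(5-)
proof (induction "card {v \<in> S. y v \<noteq> 0 \<and> y v \<noteq> 1}" arbitrary: y rule: less_induct)
  case less
  show ?case
  proof (cases "\<exists>w\<in>S. y w \<noteq> 0 \<and> y w \<noteq> 1")
    case False
    then have "y v = char_vector V {v \<in> S. y v = 1} v" for v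
      using less.prems S by (cases "v \<in> V") (auto simp: char_vector_def extensional_def indicator_def)
    then have "y = char_vector V {v \<in> S. y v = 1}"
      by blast
    then show ?thesis
      using vert[of "{v \<in> S. y v = 1}"] by auto
  next
    case True
    then obtain w where w: "w \<in> S" "y w \<noteq> 0" "y w \<noteq> 1"
      by blast
    have upd: "y(w := c) \<in> C" if c: "c = 0 \<or> c = 1" for c
    proof (rule less.hyps)
      show "card {v \<in> S. (y(w := c)) v \<noteq> 0 \<and> (y(w := c)) v \<noteq> 1} < card {v \<in> S. y v \<noteq> 0 \<and> y v \<noteq> 1}"
        by (rule psubset_card_mono) (use w c S in auto)
      show "y(w := c) \<in> extensional V"
        using less.prems(1) w S by (auto simp: extensional_def)
      show "(y(w := c)) v \<in> {0..1}" if "v \<in> S" for v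
        using less.prems(2)[OF that] c by auto
      show "(y(w := c)) v = 0" if "v \<in> V - S" for v
        using less.prems(3)[OF that] that w by auto
    qed
    have "(\<lambda>i\<in>V. y w * (y(w := 1)) i + (1 - y w) * (y(w := 0)) i) \<in> C"
      by (rule convex_on_coordsD[OF C upd upd]) (use less.prems(2)[OF w(1)] in simp_all)
    also have "(\<lambda>i\<in>V. y w * (y(w := 1)) i + (1 - y w) * (y(w := 0)) i) = y"
      using less.prems(1) by (auto simp: fun_eq_iff extensional_def algebra_simps)
    finally show ?thesis .
  qed
qed

text \<open>
  If \<open>s\<close> is the largest coordinate on \<open>A\<close>, then the coordinates on \<open>B\<close> are at most \<open>1 - s\<close>.  Hence
  \<open>x\<close> is the convex combination, with weights \<open>s\<close> and \<open>1 - s\<close>, of a point of the unit cube on \<open>A\<close> and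
  a point of the unit cube on \<open>B\<close>.  The vertices of these cubes are the characteristic vectors of
  subsets of a single side, which are independent in a bipartite graph.
\<close>

lemma bipartite_edge_polytope_in_convex_on_coords:
  assumes C: "convex_on_coords V C" and V: "finite V" "V = A \<union> B" "A \<inter> B = {}"
    and vert: "\<And>T. T \<subseteq> A \<or> T \<subseteq> B \<Longrightarrow> char_vector V T \<in> C"
    and x: "x \<in> V \<rightarrow>\<^sub>E {0..1}" "\<And>u v. u \<in> A \<Longrightarrow> v \<in> B \<Longrightarrow> x u + x v \<le> 1"
  shows "x \<in> C"
proof -
  \<comment> \<open>The inserted 0 gives \<open>s\<close> its value when \<open>A\<close> is empty.\<close>
  define s where "s = Max (insert 0 (x ` A))"
  have fin: "finite (insert 0 (x ` A))"
    using V by simp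
  have s: "0 \<le> s" "s \<le> 1"
    using fin x(1) V unfolding s_def by (auto simp: PiE_iff)
  have xA: "x u \<le> s" if "u \<in> A" for u
    using fin that unfolding s_def by (intro Max_ge) auto
  have xB: "x v \<le> 1 - s" if v: "v \<in> B" for v
  proof -
    have "s \<in> insert 0 (x ` A)"
      unfolding s_def by (rule Max_in[OF fin]) simp
    then consider "s = 0" | u where "u \<in> A" "s = x u"
      by blast
    then show ?thesis
    proof cases
      case 1
      then show ?thesis
        using x(1) v V by (auto simp: PiE_iff)
    next
      case 2
      then show ?thesis
        using x(2)[OF _ v, of u] by simp
    qed
  qed
  have x0: "0 \<le> x v" if "v \<in> V" for v
    using x(1) that by (auto simp: PiE_iff)
  \<comment> \<open>If \<open>s = 0\<close> (or \<open>s = 1\<close>), division by zero makes \<open>a\<close> (or \<open>b\<close>) the zero vector,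
    which still lies in the unit cube.\<close>
  define a where "a = (\<lambda>v\<in>V. if v \<in> A then x v / s else 0)"
  define b where "b = (\<lambda>v\<in>V. if v \<in> B then x v / (1 - s) else 0)"
  have "a \<in> C"
  proof (rule cube_in_convex_on_coords[OF C, of A])
    show "a v \<in> {0..1}" if "v \<in> A" for v
      using that V xA[OF that] x0[of v] s by (auto simp: a_def divide_le_eq_1)
  qed (use V vert in \<open>auto simp: a_def\<close>)
  moreover have "b \<in> C"
  proof (rule cube_in_convex_on_coords[OF C, of B])
    show "b v \<in> {0..1}" if "v \<in> B" for v
      using that V xB[OF that] x0[of v] s by (auto simp: b_def divide_le_eq_1)
  qed (use V vert in \<open>auto simp: b_def\<close>)
  ultimately have "(\<lambda>i\<in>V. s * a i + (1 - s) * b i) \<in> C"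
    using s by (rule convex_on_coordsD[OF C])
  also have "(\<lambda>i\<in>V. s * a i + (1 - s) * b i) = x"
  proof
    fix v
    consider "v \<in> A" "v \<notin> B" | "v \<in> B" "v \<notin> A" | "v \<notin> V"
      using V by blast
    then show "(\<lambda>i\<in>V. s * a i + (1 - s) * b i) v = x v"
    proof cases
      case 1
      then show ?thesis
        using xA[of v] x0[of v] V by (cases "s = 0") (auto simp: a_def b_def)
    next
      case 2
      then show ?thesis
        using xB[of v] x0[of v] V by (cases "s = 1") (auto simp: a_def b_def)
    next
      case 3
      then show ?thesis
        using x(1) by (simp add: PiE_iff extensional_def)
    qed
  qed
  finally show ?thesis .
qed

lemma stable_set_polytope_subset_edge_polytope:
  assumes E: "arcs_ends G \<subseteq> verts G \<times> verts G"
  shows "stable_set_polytope G \<subseteq> edge_polytope (verts G) (arcs_ends G)"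
  unfolding stable_set_polytope_def
proof (rule hull_minimal)
  show "char_vector (verts G) ` {I. independent_set G I}
      \<subseteq> edge_polytope (verts G) (arcs_ends G)"
  proof (rule image_subsetI)
    fix I assume "I \<in> {I. independent_set G I}"
    then have "char_vector (verts G) I u + char_vector (verts G) I v \<le> 1"
      if "(u, v) \<in> arcs_ends G" for u v
      using that E by (auto simp: char_vector_def independent_set_def indicator_def)
    moreover have "char_vector (verts G) I \<in> verts G \<rightarrow>\<^sub>E {0..1}"
      by (simp add: char_vector_def indicator_def)
    ultimately show "char_vector (verts G) I \<in> edge_polytope (verts G) (arcs_ends G)"
      unfolding edge_polytope_def by blast
  qed
  show "convex_on_coords (verts G) (edge_polytope (verts G) (arcs_ends G))"
    unfolding convex_on_coords_def
  proof (intro conjI ballI allI impI)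
    show "edge_polytope (verts G) (arcs_ends G) \<subseteq> extensional (verts G)"
      by (auto simp: edge_polytope_def PiE_iff)
    fix x y and p q :: real
    assume xy: "x \<in> edge_polytope (verts G) (arcs_ends G)"
        "y \<in> edge_polytope (verts G) (arcs_ends G)"
      and pq: "0 \<le> p" "0 \<le> q" "p + q = 1"
    have le1: "p * s + q * t \<le> 1" if "s \<le> 1" "t \<le> 1" for s t
      using convex_bound_le[OF that pq] .
    have "0 \<le> p * x v + q * y v" "p * x v + q * y v \<le> 1" if "v \<in> verts G" for v
      using xy pq that by (auto simp: edge_polytope_def PiE_iff intro!: le1)
    then have "(\<lambda>i\<in>verts G. p * x i + q * y i) \<in> verts G \<rightarrow>\<^sub>E {0..1}"
      by simp
    moreover have "(\<lambda>i\<in>verts G. p * x i + q * y i) u + (\<lambda>i\<in>verts G. p * x i + q * y i) v \<le> 1"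
      if uv: "(u, v) \<in> arcs_ends G" for u v
    proof -
      have "p * (x u + x v) + q * (y u + y v) \<le> 1"
        using xy uv by (intro le1) (auto simp: edge_polytope_def)
      moreover have "u \<in> verts G" "v \<in> verts G"
        using uv E by auto
      ultimately show ?thesis
        by (simp add: algebra_simps)
    qed
    ultimately show "(\<lambda>i\<in>verts G. p * x i + q * y i)
        \<in> edge_polytope (verts G) (arcs_ends G)"
      unfolding edge_polytope_def by blast
  qed
qed

lemma verts_Kdd: "verts (Kdd d) = Inl ` {..<d} \<union> Inr ` {..<d}"
  and arcs_ends_Kdd: "arcs_ends (Kdd d) = Inl ` {..<d} \<times> Inr ` {..<d} \<union> Inr ` {..<d} \<times> Inl ` {..<d}"
  by (simp_all add: Kdd_def)

lemma stable_set_polytope_Kdd: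
  "stable_set_polytope (Kdd d) = edge_polytope (verts (Kdd d)) (arcs_ends (Kdd d))"
proof
  show "stable_set_polytope (Kdd d) \<subseteq> edge_polytope (verts (Kdd d)) (arcs_ends (Kdd d))"
    by (rule stable_set_polytope_subset_edge_polytope) (auto simp: verts_Kdd arcs_ends_Kdd)
  show "edge_polytope (verts (Kdd d)) (arcs_ends (Kdd d)) \<subseteq> stable_set_polytope (Kdd d)"
    unfolding stable_set_polytope_def hull_def
  proof (rule subsetI, rule InterI, clarify)
    fix x C assume x: "x \<in> edge_polytope (verts (Kdd d)) (arcs_ends (Kdd d))"
      and C: "convex_on_coords (verts (Kdd d)) C"
      and vert: "char_vector (verts (Kdd d)) ` {I. independent_set (Kdd d) I} \<subseteq> C"
    show "x \<in> C"
    proof (rule bipartite_edge_polytope_in_convex_on_coords[OF C _ verts_Kdd])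
      show "char_vector (verts (Kdd d)) T \<in> C" if "T \<subseteq> Inl ` {..<d} \<or> T \<subseteq> Inr ` {..<d}" for T
      proof -
        have "independent_set (Kdd d) T"
          using that by (auto simp: independent_set_def verts_Kdd arcs_ends_Kdd)
        then show ?thesis
          using vert by blast
      qed
    qed (use x in \<open>auto simp: edge_polytope_def verts_Kdd arcs_ends_Kdd\<close>)
  qed
qed

text \<open>
  Gluing a labeling \<open>x\<close> of the left side to a labeling of the right side that respects the
  headroom left by \<open>x\<close> gives a threshold labeling, and different pairs give different labelings.
\<close>

lemma Kdd_count_le_card_threshold_labelings:
  assumes d: "d > 0"
  shows "Kdd_count d m \<le> real (card (threshold_labelings (verts (Kdd d)) (arcs_ends (Kdd d)) m))"
proof -
  let ?A = "Inl ` {..<d} :: (nat + nat) set" and ?B = "Inr ` {..<d} :: (nat + nat) set"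
  let ?L = "threshold_labelings (verts (Kdd d)) (arcs_ends (Kdd d)) m"
  define Y where "Y x = (?B \<rightarrow>\<^sub>E {j \<in> {..m}. \<forall>u\<in>?A. x u + j \<le> m})" for x :: "nat + nat \<Rightarrow> nat"
  define glue where "glue = (\<lambda>(x, y) v. if v \<in> ?A then x v else y v :: nat)"
  have cardA: "card ?A = d" and cardB: "card ?B = d"
    by (simp_all add: card_image)
  have "Kdd_count d m = (\<Sum>x\<in>?A \<rightarrow>\<^sub>E {..m}. real (headroom m ?A x) ^ d)"
    by (rule sum_headroom_power[symmetric]) (simp_all add: cardA d)
  also have "\<dots> = (\<Sum>x\<in>?A \<rightarrow>\<^sub>E {..m}. real (card (Y x)))"
    by (simp add: Y_def headroom_def card_funcsetE cardB)
  also have "\<dots> = real (card (SIGMA x:(?A \<rightarrow>\<^sub>E {..m}). Y x))"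
    by (simp add: card_SigmaI finite_PiE Y_def)
  also have "\<dots> \<le> real (card ?L)"
  proof (intro of_nat_mono card_inj_on_le[of glue])
    show "inj_on glue (SIGMA x:(?A \<rightarrow>\<^sub>E {..m}). Y x)"
    proof (rule inj_onI, clarify)
      fix x y x' y'
      assume xy: "x \<in> ?A \<rightarrow>\<^sub>E {..m}" "y \<in> Y x" and xy': "x' \<in> ?A \<rightarrow>\<^sub>E {..m}" "y' \<in> Y x'"
        and eq: "glue (x, y) = glue (x', y')"
      have "x v = x' v" if "v \<in> ?A" for v
        using fun_cong[OF eq, of v] that by (simp add: glue_def)
      then have "x = x'"
        using PiE_ext[OF xy(1) xy'(1)] by blast
      have "y v = y' v" if "v \<in> ?B" for v
      proof -
        have "v \<notin> ?A"
          using that by auto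
        then show ?thesis
          using fun_cong[OF eq, of v] by (simp add: glue_def)
      qed
      then have "y = y'"
        using PiE_ext[of y ?B _ y'] xy(2) xy'(2) \<open>x = x'\<close> unfolding Y_def by blast
      with \<open>x = x'\<close> show "x = x' \<and> y = y'"
        by blast
    qed
    show "glue ` (SIGMA x:(?A \<rightarrow>\<^sub>E {..m}). Y x) \<subseteq> ?L"
    proof (rule image_subsetI, clarify)
      fix x y assume x: "x \<in> ?A \<rightarrow>\<^sub>E {..m}" and y: "y \<in> Y x"
      have xu: "x (Inl i) \<le> m" if "i < d" for i
        using x that by (auto simp: PiE_iff)
      have yv: "y (Inr j) \<le> m" "\<And>i. i < d \<Longrightarrow> x (Inl i) + y (Inr j) \<le> m" if "j < d" for j
        using y that by (auto simp: Y_def PiE_iff)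
      have "glue (x, y) \<in> extensional (verts (Kdd d))"
        using y by (auto simp: glue_def Y_def verts_Kdd PiE_iff extensional_def)
      then show "glue (x, y) \<in> ?L"
        using xu yv
        by (auto simp: threshold_labelings_def verts_Kdd arcs_ends_Kdd PiE_iff glue_def add.commute)
    qed
    show "finite ?L"
      by (rule finite_threshold_labelings) (simp add: verts_Kdd)
  qed
  finally show ?thesis .
qed

section \<open>The volume bound for regular graphs\<close>

lemma regular_graph_arcs_ends:
  assumes "regular_graph G d"
  shows "finite (verts G)" and "arcs_ends G \<subseteq> verts G \<times> verts G"
    and "\<And>u. u \<in> verts G \<Longrightarrow> card {v. (u, v) \<in> arcs_ends G} = d"
    and "\<And>v. v \<in> verts G \<Longrightarrow> card {u. (u, v) \<in> arcs_ends G} = d"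
proof -
  interpret graph G
    using assms by (simp add: regular_graph_def)
  show "finite (verts G)" "arcs_ends G \<subseteq> verts G \<times> verts G"
    by (auto simp: arcs_ends_conv)
  show deg: "card {v. (u, v) \<in> arcs_ends G} = d" if "u \<in> verts G" for u
  proof -
    have "{v. (u, v) \<in> arcs_ends G} = head G ` out_arcs G u"
      by (auto simp: arcs_ends_conv)
    moreover have "inj_on (head G) (out_arcs G u)"
      by (rule inj_onI) (auto intro: no_multi_arcs simp: arc_to_ends_def)
    ultimately show ?thesis
      using assms that by (simp add: card_image regular_graph_def out_degree_def)
  qed
  show "card {u. (u, v) \<in> arcs_ends G} = d" if "v \<in> verts G" for v
  proof -
    have "{u. (u, v) \<in> arcs_ends G} = {u. (v, u) \<in> arcs_ends G}"
      using arcs_ends_symmetric[OF sym_arcs] by blast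
    then show ?thesis
      using deg[OF that] by simp
  qed
qed

lemma regular_graph_Kdd: "regular_graph (Kdd d) d"
proof -
  have "graph (Kdd d)"
    using complete_bipartite_Kdd[of d] by (simp add: complete_bipartite_digraph_def)
  moreover have "out_degree (Kdd d) v = d" if "v \<in> verts (Kdd d)" for v
  proof -
    have "out_arcs (Kdd d) v
        = {v} \<times> (if v \<in> Inl ` {..<d} then Inr ` {..<d} else Inl ` {..<d})"
      using that unfolding verts_Kdd by (auto simp: Kdd_def out_arcs_def)
    then show ?thesis
      by (simp add: out_degree_def card_cartesian_product card_image)
  qed
  ultimately show ?thesis
    by (simp add: regular_graph_def)
qed

text \<open>
  For every \<open>m\<close>, comparing cells with labelings, swapping, and the Finner inequality bound the
  squared volume by the \<open>N\<close>-th power of \<open>root d (Kdd_count d m) / m\<^sup>2\<close>, where \<open>N\<close> is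
  the number of vertices; this quotient tends to the \<open>d\<close>-th root of the reciprocal central
  binomial coefficient.
\<close>

lemma stable_set_volume_squared_le:
  assumes d: "d > 0" and G: "regular_graph G d"
  shows "stable_set_volume G ^ 2 \<le> root d (1 / real ((2 * d) choose d)) ^ card (verts G)"
proof (rule LIMSEQ_le_const)
  note VE = regular_graph_arcs_ends[OF G]
  let ?N = "card (verts G)"
  define r where "r = root d (1 / real ((2 * d) choose d))"
  have "(\<lambda>m. ((1 + real (2 * d) / real m) ^ 2 * r) ^ ?N) \<longlonglongrightarrow> ((1 + 0) ^ 2 * r) ^ ?N"
    by (intro tendsto_intros lim_const_over_n)
  then show "(\<lambda>m. ((1 + real (2 * d) / real m) ^ 2 * r) ^ ?N) \<longlonglongrightarrow> root d (1 / real ((2 * d) choose d)) ^ ?N"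
    by (simp add: r_def)
  show "\<exists>n. \<forall>m\<ge>n. stable_set_volume G ^ 2 \<le> ((1 + real (2 * d) / real m) ^ 2 * r) ^ ?N"
  proof (intro exI allI impI)
    fix m :: nat assume "1 \<le> m"
    then have m: "m > 0"
      by simp
    let ?L = "threshold_labelings (verts G) (arcs_ends G) m"
    have "stable_set_volume G \<le> real (card ?L) / real m ^ ?N"
      unfolding stable_set_volume_def
      by (rule measure_edge_polytope_le[OF VE(1,2) m stable_set_polytope_subset_edge_polytope[OF VE(2)]])
    then have "stable_set_volume G ^ 2 \<le> (real (card ?L) / real m ^ ?N) ^ 2"
      by (rule power_mono) (simp add: stable_set_volume_def)
    also have "\<dots> = real (card ?L ^ 2) / (real m ^ 2) ^ ?N"
      by (simp add: power_divide mult.commute flip: power_mult)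
    also have "\<dots> \<le> real (card (crossed_labelings (verts G) (arcs_ends G) m)) / (real m ^ 2) ^ ?N"
      by (intro divide_right_mono of_nat_mono card_threshold_labelings_squared_le[OF VE(1,2)]) simp
    also have "\<dots> \<le> root d (Kdd_count d m) ^ ?N / (real m ^ 2) ^ ?N"
      by (intro divide_right_mono card_crossed_labelings_le[OF VE(1,2) d VE(3,4)]) simp_all
    also have "\<dots> = (root d (Kdd_count d m) / real m ^ 2) ^ ?N"
      by (simp add: power_divide)
    also have "\<dots> \<le> ((1 + real (2 * d) / real m) ^ 2 * r) ^ ?N"
    proof (rule power_mono)
      have "root d (Kdd_count d m) \<le> root d (real (m + 2 * d) ^ (2 * d) / real ((2 * d) choose d))"
        using Kdd_count_bounds(2)[OF d] d by simp
      also have "\<dots> = root d ((real (m + 2 * d) ^ 2) ^ d * (1 / real ((2 * d) choose d)))"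
        by (simp add: power_mult)
      also have "\<dots> = real (m + 2 * d) ^ 2 * r"
        using d by (simp only: real_root_mult real_root_power_cancel zero_le_power of_nat_0_le_iff r_def)
      finally have "root d (Kdd_count d m) / real m ^ 2 \<le> (real (m + 2 * d) ^ 2 * r) / real m ^ 2"
        by (rule divide_right_mono) simp
      also have "\<dots> = (1 + real (2 * d) / real m) ^ 2 * r"
        using m by (simp add: field_simps)
      finally show "root d (Kdd_count d m) / real m ^ 2 \<le> (1 + real (2 * d) / real m) ^ 2 * r" .
      have "0 \<le> Kdd_count d m"
        using Kdd_count_bounds(1)[OF d, of m] by (rule order_trans[rotated]) simp
      then show "0 \<le> root d (Kdd_count d m) / real m ^ 2"
        using d by simp
    qed
    finally show "stable_set_volume G ^ 2 \<le> ((1 + real (2 * d) / real m) ^ 2 * r) ^ ?N" .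
  qed
qed

lemma stable_set_volume_le:
  assumes d: "d > 0" and G: "regular_graph G d"
  shows "stable_set_volume G \<le> real ((2 * d) choose d) powr (- (real (card (verts G)) / (2 * real d)))"
proof (rule power2_le_imp_le)
  let ?c = "real ((2 * d) choose d)"
  have c: "?c > 0"
    by simp
  have "stable_set_volume G ^ 2 \<le> root d (1 / ?c) ^ card (verts G)"
    by (rule stable_set_volume_squared_le[OF d G])
  also have "root d (1 / ?c) = ?c powr (- (1 / real d))"
    using c d by (simp add: root_powr_inverse powr_divide powr_minus_divide)
  also have "(?c powr (- (1 / real d))) ^ card (verts G) = ?c powr (- (real (card (verts G)) / real d))"
    using c by (simp add: powr_powr flip: powr_realpow)
  also have "\<dots> = (?c powr (- (real (card (verts G)) / (2 * real d)))) ^ 2"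
    using c d by (simp add: power2_eq_square flip: powr_add)
  finally show "stable_set_volume G ^ 2 \<le> (?c powr (- (real (card (verts G)) / (2 * real d)))) ^ 2" .
qed simp

text \<open>
  The upper bound is the general one, since \<open>K\<^bsub>d,d\<^esub>\<close> is itself \<open>d\<close>-regular on \<open>2 * d\<close> vertices.
  The lower bound comes from the cells inside the edge polytope, which here is the
  stable set polytope.
\<close>

lemma stable_set_volume_Kdd:
  assumes d: "d > 0"
  shows "stable_set_volume (Kdd d) = 1 / real ((2 * d) choose d)"
proof (rule antisym)
  let ?c = "real ((2 * d) choose d)"
  have card: "card (verts (Kdd d)) = 2 * d"
    unfolding verts_Kdd by (subst card_Un_disjoint) (auto simp: card_image)
  show "stable_set_volume (Kdd d) \<le> 1 / ?c"
    using stable_set_volume_le[OF d regular_graph_Kdd] d by (simp add: card powr_minus_divide)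
  show "1 / ?c \<le> stable_set_volume (Kdd d)"
  proof (rule LIMSEQ_le_const2)
    have "(\<lambda>n. (1 - real (2 * d) / real n) ^ (2 * d) / ?c) \<longlonglongrightarrow> (1 - 0) ^ (2 * d) / ?c"
      by (intro tendsto_intros lim_const_over_n) simp
    then show "(\<lambda>n. (1 - real (2 * d) / real n) ^ (2 * d) / ?c) \<longlonglongrightarrow> 1 / ?c"
      by simp
    show "\<exists>n0. \<forall>n\<ge>n0. (1 - real (2 * d) / real n) ^ (2 * d) / ?c \<le> stable_set_volume (Kdd d)"
    proof (intro exI allI impI)
      fix n assume n: "2 * d + 2 \<le> n"
      define m where "m = n - 2"
      have nm: "n = m + 2"
        using n by (simp add: m_def)
      let ?L = "threshold_labelings (verts (Kdd d)) (arcs_ends (Kdd d)) m"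
      have "(1 - real (2 * d) / real n) ^ (2 * d) / ?c
          = (real (m + 2 - 2 * d) ^ (2 * d) / ?c) / real (m + 2) ^ (2 * d)"
      proof -
        have "1 - real (2 * d) / real n = real (m + 2 - 2 * d) / real (m + 2)"
          using n by (simp add: nm of_nat_diff field_simps)
        then show ?thesis
          by (simp only: power_divide) simp
      qed
      also have "\<dots> \<le> real (card ?L) / real (m + 2) ^ (2 * d)"
        by (intro divide_right_mono order_trans[OF Kdd_count_bounds(1)[OF d]]
            Kdd_count_le_card_threshold_labelings[OF d]) simp
      also have "\<dots> \<le> stable_set_volume (Kdd d)"
        using measure_edge_polytope_ge[OF regular_graph_arcs_ends(1,2)[OF regular_graph_Kdd[of d]], where m = m]
        unfolding stable_set_volume_def stable_set_polytope_Kdd card .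
      finally show "(1 - real (2 * d) / real n) ^ (2 * d) / ?c \<le> stable_set_volume (Kdd d)" .
    qed
  qed
qed

theorem theorem2p10:
  fixes G :: "('a, 'b) pre_digraph" and d N :: nat
  assumes "d \<ge> 1"
    and "regular_graph G d"
    and "card (verts G) = N"
  shows "stable_set_volume G \<le> stable_set_volume (Kdd d) powr (real N / (2 * real d)) \<and>
         stable_set_volume (Kdd d) powr (real N / (2 * real d)) =
           real ((2 * d) choose d) powr (- (real N / (2 * real d)))"
proof -
  have d: "d > 0"
    using assms(1) by simp
  have "stable_set_volume (Kdd d) powr (real N / (2 * real d))
      = real ((2 * d) choose d) powr (- (real N / (2 * real d)))"
    by (simp add: stable_set_volume_Kdd[OF d] powr_divide powr_minus_divide)
  then show ?thesis
    using stable_set_volume_le[OF d assms(2)] assms(3) by simp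
qed

end
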